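(* For a left state $(\rho_L,m_L,\mathcal{E}_L)$ and a right state $(\rho_R,m_R,\mathcal{E}_R)$ of the one-dimensional Riemann problem for the Euler equations with the co-volume equation of state, the smallest and largest wave speeds satisfy the gap condition $$\lambda_3^+-\lambda_1^-\ \ge\ c(\gamma)\,(a_L+a_R),$$ where $a_L,a_R$ are the local sound speeds and $$c(\gamma):=\begin{cases}\dfrac{2\sqrt{2(\gamma-1)}}{\gamma+1}&\text{if }\gamma\in(1,3],\\[2mm] 1&\text{if }\gamma\in(3,+\infty).\end{cases}$$
   Context: Fix $\gamma>1$ and $b\ge0$. The one-dimensional Euler system is $\partial_t\rho+\partial_x m=0$, $\partial_t m+\partial_x(\tfrac{m^2}{\rho}+p)=0$, $\partial_t\mathcal{E}+\partial_x(\tfrac{m}{\rho}(\mathcal{E}+p))=0$, with co-volume equation of state $p(1-b\rho)=(\gamma-1)(\mathcal{E}-\tfrac{m^2}{2\rho})$. For $Z\in\{L,R\}$ the states are non-vacuum and admissible: $\rho_Z>0$, $1-b\rho_Z>0$; write $u_Z=m_Z/\rho_Z$, $p_Z$ for the pressure given by the equation of state, and assume $p_Z>0$. The local sound speed is $a_Z:=\sqrt{\frac{\gamma p_Z}{\rho_Z(1-b\rho_Z)}}$. Set $A_Z:=\frac{2(1-b\rho_Z)}{(\gamma+1)\rho_Z}$, $B_Z:=\frac{\gamma-1}{\gamma+1}p_Z$, and for $p\ge0$ $$f(p,Z):=\begin{cases}(p-p_Z)\left(\frac{A_Z}{p+B_Z}\right)^{1/2}&\text{if }p\ge p_Z,\\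 \frac{2a_Z(1-b\rho_Z)}{\gamma-1}\left(\left(\frac{p}{p_Z}\right)^{\frac{\gamma-1}{2\gamma}}-1\right)&\text{if }p<p_Z,\end{cases}\qquad \phi(p):=f(p,L)+f(p,R)+u_R-u_L.$$ The function $\phi$ is strictly increasing and tends to $+\infty$. If $\phi(0)<0$, $p^*$ denotes the unique positive zero of $\phi$; otherwise (formation of vacuum) $p^*:=0$ by convention. With $z_+:=\max(0,z)$, the two extreme wave speeds enclosing the Riemann fan are $$\lambda_1^-=u_L-a_L\left(1+\frac{\gamma+1}{2\gamma}\left(\frac{p^*-p_L}{p_L}\right)_+\right)^{1/2},\qquad \lambda_3^+=u_R+a_R\left(1+\frac{\gamma+1}{2\gamma}\left(\frac{p^*-p_R}{p_R}\right)_+\right)^{1/2}.$$ *)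

theory Defs
  imports Complex_Main
begin

record euler_state =
  dens :: real
  mom :: real
  energy :: real

definition velocity :: "euler_state \<Rightarrow> real" where
  "velocity Z = mom Z / dens Z"

text \<open>The co-volume equation of state
  \<open>p * (1 - b * \<rho>) = (\<gamma> - 1) * (E - m^2 / (2 * \<rho>))\<close>, solved for \<open>p\<close>; the functions below are meant
  for states satisfying \<open>admissible\<close>, where no denominator vanishes.\<close>

definition pressure :: "real \<Rightarrow> real \<Rightarrow> euler_state \<Rightarrow> real" where
  "pressure \<gamma> b Z =
     (\<gamma> - 1) * (energy Z - (mom Z)\<^sup>2 / (2 * dens Z)) / (1 - b * dens Z)"

definition admissible :: "real \<Rightarrow> real \<Rightarrow> euler_state \<Rightarrow> bool" where
  "admissible \<gamma> b Z \<longleftrightarrow> dens Z > 0 \<and> 1 - b * dens Z > 0 \<and> pressure \<gamma> b Z > 0"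

definition sound_speed :: "real \<Rightarrow> real \<Rightarrow> euler_state \<Rightarrow> real" where
  "sound_speed \<gamma> b Z = sqrt (\<gamma> * pressure \<gamma> b Z / (dens Z * (1 - b * dens Z)))"

definition coeff_A :: "real \<Rightarrow> real \<Rightarrow> euler_state \<Rightarrow> real" where
  "coeff_A \<gamma> b Z = 2 * (1 - b * dens Z) / ((\<gamma> + 1) * dens Z)"

definition coeff_B :: "real \<Rightarrow> real \<Rightarrow> euler_state \<Rightarrow> real" where
  "coeff_B \<gamma> b Z = (\<gamma> - 1) / (\<gamma> + 1) * pressure \<gamma> b Z"

text \<open>The shock branch (\<open>p \<ge> p\<^sub>Z\<close>) and the rarefaction branch (\<open>p < p\<^sub>Z\<close>) of the wave curve
  through \<open>Z\<close>. Only arguments \<open>p \<ge> 0\<close> are meaningful; at \<open>p = 0\<close> the real power is \<open>0\<close>, as it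
  should be for a positive exponent.\<close>

definition wave_curve :: "real \<Rightarrow> real \<Rightarrow> real \<Rightarrow> euler_state \<Rightarrow> real" where
  "wave_curve \<gamma> b p Z =
     (if p \<ge> pressure \<gamma> b Z
      then (p - pressure \<gamma> b Z) * sqrt (coeff_A \<gamma> b Z / (p + coeff_B \<gamma> b Z))
      else 2 * sound_speed \<gamma> b Z * (1 - b * dens Z) / (\<gamma> - 1)
             * ((p / pressure \<gamma> b Z) powr ((\<gamma> - 1) / (2 * \<gamma>)) - 1))"

definition phi :: "real \<Rightarrow> real \<Rightarrow> euler_state \<Rightarrow> euler_state \<Rightarrow> real \<Rightarrow> real" where
  "phi \<gamma> b L R p = wave_curve \<gamma> b p L + wave_curve \<gamma> b p R + velocity R - velocity L"

text \<open>For admissible states \<open>phi\<close> is continuous and strictly increasing on the nonnegative reals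
  and tends to infinity, so the description below denotes a unique zero. The value \<open>0\<close> is the
  convention for formation of vacuum.\<close>

definition p_star :: "real \<Rightarrow> real \<Rightarrow> euler_state \<Rightarrow> euler_state \<Rightarrow> real" where
  "p_star \<gamma> b L R =
     (if phi \<gamma> b L R 0 < 0 then THE p. p > 0 \<and> phi \<gamma> b L R p = 0 else 0)"

definition lambda1_minus :: "real \<Rightarrow> real \<Rightarrow> euler_state \<Rightarrow> euler_state \<Rightarrow> real" where
  "lambda1_minus \<gamma> b L R =
     velocity L - sound_speed \<gamma> b L *
       sqrt (1 + (\<gamma> + 1) / (2 * \<gamma>)
               * max 0 ((p_star \<gamma> b L R - pressure \<gamma> b L) / pressure \<gamma> b L))"

definition lambda3_plus :: "real \<Rightarrow> real \<Rightarrow> euler_state \<Rightarrow> euler_state \<Rightarrow> real" where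
  "lambda3_plus \<gamma> b L R =
     velocity R + sound_speed \<gamma> b R *
       sqrt (1 + (\<gamma> + 1) / (2 * \<gamma>)
               * max 0 ((p_star \<gamma> b L R - pressure \<gamma> b R) / pressure \<gamma> b R))"

definition gap_const :: "real \<Rightarrow> real" where
  "gap_const \<gamma> = (if \<gamma> \<le> 3 then 2 * sqrt (2 * (\<gamma> - 1)) / (\<gamma> + 1) else 1)"

end

theory Submission
  imports Defs
begin

text \<open>
  Write \<open>S\<^sub>Z\<close> for the square root that multiplies the sound speed \<open>a\<^sub>Z\<close> in the extreme wave
  speeds; it is the Mach number of the shock, and \<open>1\<close> for a rarefaction. In every case
  \<open>phi p\<^sup>* \<ge> 0\<close>: with equality if \<open>p\<^sup>*\<close> is a zero of \<open>phi\<close>, and by the vacuum condition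
  \<open>phi 0 \<ge> 0\<close> if \<open>p\<^sup>* = 0\<close>. This bounds \<open>u\<^sub>R - u\<^sub>L\<close> from below by the two wave curves, so the
  gap is at least the sum of one term \<open>a\<^sub>Z S\<^sub>Z - f(p\<^sup>*, Z)\<close> for each side. For a rarefaction
  \<open>f \<le> 0\<close>, and the term is at least \<open>a\<^sub>Z\<close>. On the shock branch the wave curve is
  \<open>f = 2 a\<^sub>Z (1 - b\<rho>\<^sub>Z) (S\<^sub>Z - 1 / S\<^sub>Z) / (\<gamma> + 1)\<close> (lemma \<open>shock_branch\<close>), and as \<open>1 - b\<rho>\<^sub>Z \<le> 1\<close>
  the term is at least \<open>a\<^sub>Z ((\<gamma> - 1) S\<^sub>Z + 2 / S\<^sub>Z) / (\<gamma> + 1)\<close>. The minimum of this expression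
  over \<open>S\<^sub>Z \<ge> 1\<close> is \<open>c(\<gamma>) a\<^sub>Z\<close>: for \<open>\<gamma> \<le> 3\<close> the unconstrained minimiser \<open>S\<^sup>2 = 2 / (\<gamma> - 1)\<close> of
  the arithmetic-geometric mean inequality is feasible, and for \<open>\<gamma> > 3\<close> the minimum is at the
  boundary \<open>S\<^sub>Z = 1\<close> (lemma \<open>gap_const_le_shock\<close>).

  For \<open>p\<^sup>*\<close> to be a zero of \<open>phi\<close> in the first place, \<open>phi\<close> must have exactly one positive zero.
  This follows from strict monotonicity, continuity and unboundedness of the wave curves. The
  first two are read off from a formula without case distinction (lemma \<open>wave_curve_split\<close>),
  the last from the shock branch, since \<open>S\<^sub>Z\<close> grows like the square root of the pressure.
\<close>

section \<open>The wave curve in terms of the shock Mach number\<close>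

definition mach :: "real \<Rightarrow> real \<Rightarrow> real \<Rightarrow> euler_state \<Rightarrow> real" where
  "mach \<gamma> b p Z = sqrt (1 + (\<gamma> + 1) / (2 * \<gamma>)
                     * max 0 ((p - pressure \<gamma> b Z) / pressure \<gamma> b Z))"

lemma sound_speed_pos:
  assumes "\<gamma> > 1" "admissible \<gamma> b Z"
  shows "sound_speed \<gamma> b Z > 0"
  using assms unfolding sound_speed_def admissible_def by simp

lemma mach_ge_1:
  assumes "\<gamma> > 1"
  shows "mach \<gamma> b p Z \<ge> 1"
  using assms unfolding mach_def by simp

lemma mach_eq_1:
  assumes "admissible \<gamma> b Z" "p \<le> pressure \<gamma> b Z"
  shows "mach \<gamma> b p Z = 1"
  using assms unfolding mach_def admissible_def by (simp add: divide_le_0_iff)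

lemma mach_mono:
  assumes "\<gamma> > 1" "admissible \<gamma> b Z" "p \<le> q"
  shows "mach \<gamma> b p Z \<le> mach \<gamma> b q Z"
proof -
  have "(p - pressure \<gamma> b Z) / pressure \<gamma> b Z \<le> (q - pressure \<gamma> b Z) / pressure \<gamma> b Z"
    using assms by (auto simp: admissible_def intro!: divide_right_mono)
  then show ?thesis
    unfolding mach_def using assms(1)
    by (intro real_sqrt_le_mono add_left_mono mult_left_mono max.mono) auto
qed

lemma mach_strict_mono:
  assumes "\<gamma> > 1" "admissible \<gamma> b Z" "pressure \<gamma> b Z \<le> p" "p < q"
  shows "mach \<gamma> b p Z < mach \<gamma> b q Z"
proof -
  have "(p - pressure \<gamma> b Z) / pressure \<gamma> b Z < (q - pressure \<gamma> b Z) / pressure \<gamma> b Z"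
       "0 \<le> (p - pressure \<gamma> b Z) / pressure \<gamma> b Z"
    using assms by (auto simp: admissible_def intro!: divide_strict_right_mono)
  then have "max 0 ((p - pressure \<gamma> b Z) / pressure \<gamma> b Z)
           < max 0 ((q - pressure \<gamma> b Z) / pressure \<gamma> b Z)" by linarith
  then show ?thesis
    unfolding mach_def using assms(1)
    by (intro real_sqrt_less_mono add_strict_left_mono mult_strict_left_mono) auto
qed

lemma diff_inverse_strict_mono:
  fixes s t :: real
  assumes "0 < s" "s < t"
  shows "s - 1 / s < t - 1 / t"
proof -
  have "1 / t < 1 / s" using assms by (simp add: frac_less2)
  then show ?thesis using assms by linarith
qed

text \<open>With \<open>r = 1 - b\<rho>\<close>, the Rankine-Hugoniot factor has the closed form
  \<open>a r / (\<gamma> S p\<^sub>Z)\<close>, because \<open>2 \<gamma> p\<^sub>Z S\<^sup>2 = (\<gamma> + 1) p + (\<gamma> - 1) p\<^sub>Z\<close> is, up to the factor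
  \<open>\<gamma> + 1\<close>, the denominator \<open>p + B\<^sub>Z\<close>; the pressure jump is in turn
  \<open>p - p\<^sub>Z = 2 \<gamma> p\<^sub>Z (S\<^sup>2 - 1) / (\<gamma> + 1)\<close>.\<close>

lemma shock_branch:
  assumes g: "\<gamma> > 1" and adm: "admissible \<gamma> b Z" and p: "p \<ge> pressure \<gamma> b Z"
  shows "(p - pressure \<gamma> b Z) * sqrt (coeff_A \<gamma> b Z / (p + coeff_B \<gamma> b Z))
       = 2 / (\<gamma> + 1) * (sound_speed \<gamma> b Z * (1 - b * dens Z))
           * (mach \<gamma> b p Z - 1 / mach \<gamma> b p Z)"
proof -
  define P where "P = pressure \<gamma> b Z"
  define d where "d = dens Z"
  define r where "r = 1 - b * dens Z"
  define a where "a = sound_speed \<gamma> b Z"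
  define S where "S = mach \<gamma> b p Z"
  have pos: "P > 0" "d > 0" "r > 0" "p \<ge> P"
    using adm p by (auto simp: admissible_def P_def d_def r_def)
  have S1: "S \<ge> 1" using mach_ge_1[OF g] by (simp add: S_def)
  have a0: "a > 0" using sound_speed_pos[OF g adm] by (simp add: a_def)
  have a2: "a\<^sup>2 = \<gamma> * P / (d * r)"
    using pos g by (simp add: a_def sound_speed_def P_def d_def r_def)
  have S2: "S\<^sup>2 = 1 + (\<gamma> + 1) / (2 * \<gamma>) * ((p - P) / P)"
    using pos g unfolding S_def mach_def P_def[symmetric] by (simp add: max_def)
  have S2': "2 * \<gamma> * P * S\<^sup>2 = (\<gamma> + 1) * p + (\<gamma> - 1) * P"
    unfolding S2 using pos g by (simp add: field_simps)
  have "coeff_A \<gamma> b Z / (p + coeff_B \<gamma> b Z)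
        = (2 * r / ((\<gamma> + 1) * d)) / (p + (\<gamma> - 1) / (\<gamma> + 1) * P)"
    by (simp add: coeff_A_def coeff_B_def P_def r_def d_def)
  also have "\<dots> = 2 * r / (d * ((\<gamma> + 1) * p + (\<gamma> - 1) * P))"
  proof -
    have "p + (\<gamma> - 1) / (\<gamma> + 1) * P = ((\<gamma> + 1) * p + (\<gamma> - 1) * P) / (\<gamma> + 1)"
      using g by (simp add: field_simps)
    then show ?thesis using g by simp
  qed
  also have "\<dots> = r / (d * (\<gamma> * P * S\<^sup>2))"
    unfolding S2'[symmetric] by simp
  also have "\<dots> = (a * r / (\<gamma> * S * P))\<^sup>2"
    unfolding power_divide power_mult_distrib a2 using pos g S1
    by (simp add: field_simps power2_eq_square)
  finally have "sqrt (coeff_A \<gamma> b Z / (p + coeff_B \<gamma> b Z)) = a * r / (\<gamma> * S * P)"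
    using pos g S1 a0 by simp
  moreover have "p - P = 2 * \<gamma> * P / (\<gamma> + 1) * (S\<^sup>2 - 1)"
    unfolding S2 using pos g by simp
  ultimately have "(p - P) * sqrt (coeff_A \<gamma> b Z / (p + coeff_B \<gamma> b Z))
      = (2 * \<gamma> * P / (\<gamma> + 1) * (S\<^sup>2 - 1)) * (a * r / (\<gamma> * S * P))"
    by simp
  also have "\<dots> = 2 / (\<gamma> + 1) * (a * r) * ((S\<^sup>2 - 1) / S)"
    using pos g S1 by simp
  also have "(S\<^sup>2 - 1) / S = S - 1 / S"
    using S1 by (simp add: field_simps power2_eq_square)
  finally show ?thesis by (simp add: P_def S_def a_def r_def)
qed

text \<open>Truncating both branches at \<open>p\<^sub>Z\<close>, where each vanishes, makes the wave curve a sum of two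
  terms that are continuous and nondecreasing on the whole half line.\<close>

lemma wave_curve_split:
  assumes "\<gamma> > 1" "admissible \<gamma> b Z"
  shows "wave_curve \<gamma> b p Z
       = 2 / (\<gamma> + 1) * (sound_speed \<gamma> b Z * (1 - b * dens Z))
           * (mach \<gamma> b p Z - 1 / mach \<gamma> b p Z)
         + 2 * sound_speed \<gamma> b Z * (1 - b * dens Z) / (\<gamma> - 1)
             * (min 1 (p / pressure \<gamma> b Z) powr ((\<gamma> - 1) / (2 * \<gamma>)) - 1)"
proof (cases "p \<ge> pressure \<gamma> b Z")
  case True
  moreover have "min 1 (p / pressure \<gamma> b Z) = 1"
    using assms True by (simp add: admissible_def min_def)
  ultimately show ?thesis
    using shock_branch[OF assms True] by (simp add: wave_curve_def)
next
  case False
  moreover have "min 1 (p / pressure \<gamma> b Z) = p / pressure \<gamma> b Z"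
    using assms False by (simp add: admissible_def min_def)
  ultimately show ?thesis
    using mach_eq_1[OF assms(2), of p] by (simp add: wave_curve_def)
qed

lemma wave_curve_nonneg:
  assumes "\<gamma> > 1" "admissible \<gamma> b Z" "pressure \<gamma> b Z \<le> p"
  shows "0 \<le> wave_curve \<gamma> b p Z"
  using assms unfolding wave_curve_def coeff_A_def coeff_B_def admissible_def by simp

lemma wave_curve_strict_mono:
  assumes g: "\<gamma> > 1" and adm: "admissible \<gamma> b Z" and pq: "0 \<le> p" "p < q"
  shows "wave_curve \<gamma> b p Z < wave_curve \<gamma> b q Z"
proof -
  let ?P = "pressure \<gamma> b Z" and ?e = "(\<gamma> - 1) / (2 * \<gamma>)"
  let ?c = "2 / (\<gamma> + 1) * (sound_speed \<gamma> b Z * (1 - b * dens Z))"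
  let ?d = "2 * sound_speed \<gamma> b Z * (1 - b * dens Z) / (\<gamma> - 1)"
  let ?s = "\<lambda>p. mach \<gamma> b p Z - 1 / mach \<gamma> b p Z"
  let ?t = "\<lambda>p. min 1 (p / ?P) powr ?e - 1"
  have P: "?P > 0" and r: "1 - b * dens Z > 0" using adm by (auto simp: admissible_def)
  have c: "?c > 0" and d: "?d > 0" using sound_speed_pos[OF g adm] r g by auto
  have m0: "mach \<gamma> b p Z > 0" using mach_ge_1[OF g, of b p Z] by linarith
  have s_le: "?s p \<le> ?s q"
    using diff_inverse_strict_mono[OF m0, of "mach \<gamma> b q Z"] mach_mono[OF g adm, of p q] pq(2)
    by (cases "mach \<gamma> b p Z = mach \<gamma> b q Z") auto
  have t_le: "?t p \<le> ?t q"
    using P pq g by (auto intro!: powr_mono2 min.mono divide_right_mono)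
  show ?thesis
  proof (cases "?P \<le> p")
    case True
    then have "?s p < ?s q"
      using diff_inverse_strict_mono[OF m0] mach_strict_mono[OF g adm True pq(2)] by blast
    then have "?c * ?s p < ?c * ?s q" using c by (intro mult_strict_left_mono)
    moreover have "?d * ?t p \<le> ?d * ?t q" using d t_le by (intro mult_left_mono) auto
    ultimately show ?thesis unfolding wave_curve_split[OF g adm] by linarith
  next
    case False
    then have "min 1 (p / ?P) < min 1 (q / ?P)" using P pq by (auto simp: min_def field_simps)
    then have "?t p < ?t q" using P pq g by (auto intro!: powr_less_mono2)
    then have "?d * ?t p < ?d * ?t q" using d by (intro mult_strict_left_mono)
    moreover have "?c * ?s p \<le> ?c * ?s q" using c s_le by (intro mult_left_mono) auto
    ultimately show ?thesis unfolding wave_curve_split[OF g adm] by linarith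
  qed
qed

lemma continuous_on_wave_curve:
  assumes g: "\<gamma> > 1" and adm: "admissible \<gamma> b Z"
  shows "continuous_on {0..} (\<lambda>p. wave_curve \<gamma> b p Z)"
proof -
  have P: "pressure \<gamma> b Z > 0" using adm by (simp add: admissible_def)
  have m: "continuous_on {0..} (\<lambda>p. mach \<gamma> b p Z)"
    unfolding mach_def using P by (intro continuous_intros) auto
  have m0: "mach \<gamma> b p Z \<noteq> 0" for p using mach_ge_1[OF g, of b p Z] by auto
  have t: "continuous_on {0..} (\<lambda>p. min 1 (p / pressure \<gamma> b Z) powr ((\<gamma> - 1) / (2 * \<gamma>)))"
    using P g by (intro continuous_on_powr' continuous_intros) auto
  show ?thesis
    unfolding wave_curve_split[OF g adm]
    by (intro continuous_on_add continuous_on_mult_left continuous_on_diff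
          continuous_on_divide continuous_on_const m t) (simp add: m0)
qed

lemma wave_curve_unbounded:
  assumes g: "\<gamma> > 1" and adm: "admissible \<gamma> b Z"
  shows "\<exists>p > 0. wave_curve \<gamma> b p Z \<ge> K"
proof -
  let ?P = "pressure \<gamma> b Z"
  define c where "c = 2 / (\<gamma> + 1) * (sound_speed \<gamma> b Z * (1 - b * dens Z))"
  have P: "?P > 0" using adm by (auto simp: admissible_def)
  have c: "c > 0"
    unfolding c_def using sound_speed_pos[OF g adm] g adm
    by (intro mult_pos_pos) (simp_all add: admissible_def)
  define T where "T = 1 + \<bar>K\<bar> / c"
  \<comment> \<open>the pressure behind a shock of Mach number at least \<open>T\<close>\<close>
  define p where "p = ?P * (1 + 2 * \<gamma> / (\<gamma> + 1) * T\<^sup>2)"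
  have T: "T \<ge> 1" using c by (simp add: T_def)
  have x: "(p - ?P) / ?P = 2 * \<gamma> / (\<gamma> + 1) * T\<^sup>2"
    using P by (simp add: p_def distrib_left)
  have x0: "(p - ?P) / ?P \<ge> 0" unfolding x using g by simp
  then have pP: "p \<ge> ?P" using P by (simp add: zero_le_divide_iff)
  have "mach \<gamma> b p Z = sqrt (1 + (\<gamma> + 1) / (2 * \<gamma>) * (2 * \<gamma> / (\<gamma> + 1) * T\<^sup>2))"
    unfolding mach_def using x x0 by (simp add: max_def)
  also have "\<dots> = sqrt (1 + T\<^sup>2)" using g by simp
  also have "\<dots> \<ge> T" by (rule real_le_rsqrt) simp
  finally have M: "mach \<gamma> b p Z \<ge> T" .
  have "1 / mach \<gamma> b p Z \<le> 1" using mach_ge_1[OF g, of b p Z] by simp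
  then have "\<bar>K\<bar> / c \<le> mach \<gamma> b p Z - 1 / mach \<gamma> b p Z"
    using M unfolding T_def by linarith
  then have "\<bar>K\<bar> \<le> c * (mach \<gamma> b p Z - 1 / mach \<gamma> b p Z)"
    using c by (simp add: pos_divide_le_eq mult.commute)
  also have "\<dots> = wave_curve \<gamma> b p Z"
    using shock_branch[OF g adm pP] pP by (simp add: wave_curve_def c_def)
  finally have "K \<le> wave_curve \<gamma> b p Z" by linarith
  then show ?thesis using P pP by (intro exI[of _ p]) auto
qed

section \<open>The star pressure\<close>

lemma phi_strict_mono:
  assumes "\<gamma> > 1" "admissible \<gamma> b L" "admissible \<gamma> b R" "0 \<le> p" "p < q"
  shows "phi \<gamma> b L R p < phi \<gamma> b L R q"
  using wave_curve_strict_mono[OF assms(1,2,4,5)] wave_curve_strict_mono[OF assms(1,3,4,5)]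
  by (simp add: phi_def)

lemma phi_has_zero:
  assumes g: "\<gamma> > 1" and L: "admissible \<gamma> b L" and R: "admissible \<gamma> b R"
    and neg: "phi \<gamma> b L R 0 < 0"
  shows "\<exists>p > 0. phi \<gamma> b L R p = 0"
proof -
  obtain q where q: "q > 0" "wave_curve \<gamma> b q L \<ge> velocity L - velocity R"
    using wave_curve_unbounded[OF g L] by blast
  \<comment> \<open>beyond \<open>p\<^sub>R\<close> the right wave curve is nonnegative, so the left one alone decides the sign\<close>
  define p where "p = max q (pressure \<gamma> b R)"
  have "wave_curve \<gamma> b q L \<le> wave_curve \<gamma> b p L"
    using wave_curve_strict_mono[OF g L, of q p] q(1) unfolding p_def
    by (cases "q < pressure \<gamma> b R") auto
  moreover have "wave_curve \<gamma> b p R \<ge> 0"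
    by (rule wave_curve_nonneg[OF g R]) (simp add: p_def)
  ultimately have "phi \<gamma> b L R p \<ge> 0" using q by (simp add: phi_def)
  moreover have "continuous_on {0..p} (phi \<gamma> b L R)"
    unfolding phi_def
    by (intro continuous_intros
          continuous_on_subset[OF continuous_on_wave_curve[OF g L]]
          continuous_on_subset[OF continuous_on_wave_curve[OF g R]]) auto
  moreover have "0 \<le> p" using q(1) by (simp add: p_def)
  ultimately obtain x where "0 \<le> x" "phi \<gamma> b L R x = 0"
    using IVT'[of "phi \<gamma> b L R" 0 0 p] neg by auto
  then show ?thesis using neg by (metis order_less_irrefl order_le_less)
qed

lemma p_star_zero:
  assumes g: "\<gamma> > 1" and L: "admissible \<gamma> b L" and R: "admissible \<gamma> b R"
    and neg: "phi \<gamma> b L R 0 < 0"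
  shows "p_star \<gamma> b L R > 0 \<and> phi \<gamma> b L R (p_star \<gamma> b L R) = 0"
proof -
  obtain p where p: "p > 0" "phi \<gamma> b L R p = 0" using phi_has_zero[OF assms] by blast
  have "q = p" if "q > 0" "phi \<gamma> b L R q = 0" for q
    using phi_strict_mono[OF g L R, of p q] phi_strict_mono[OF g L R, of q p] p that
    by linarith
  then have "(THE p. p > 0 \<and> phi \<gamma> b L R p = 0) = p"
    using p by blast
  then show ?thesis using p neg by (simp add: p_star_def)
qed

section \<open>The gap condition\<close>

lemma gap_const_le_1:
  assumes "\<gamma> > 1"
  shows "gap_const \<gamma> \<le> 1"
proof -
  have "0 \<le> (\<gamma> - 3)\<^sup>2" by simp
  then have "2\<^sup>2 * (2 * (\<gamma> - 1)) \<le> (\<gamma> + 1)\<^sup>2" by (simp add: power2_eq_square algebra_simps)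
  then have "sqrt (2\<^sup>2 * (2 * (\<gamma> - 1))) \<le> \<gamma> + 1" using assms by (intro real_le_lsqrt) auto
  then have "2 * sqrt (2 * (\<gamma> - 1)) \<le> \<gamma> + 1" by (simp only: real_sqrt_mult) simp
  then show ?thesis using assms by (simp add: gap_const_def)
qed

text \<open>For \<open>\<gamma> \<le> 3\<close> this is the arithmetic-geometric mean inequality for \<open>(\<gamma> - 1) S\<close> and
  \<open>2 / S\<close>. For \<open>\<gamma> > 3\<close> the right side minus the left side is
  \<open>(S - 1) ((\<gamma> - 1) S - 2) / ((\<gamma> + 1) S)\<close>, a product of nonnegative factors.\<close>

lemma gap_const_le_shock:
  assumes g: "\<gamma> > 1" and S: "S \<ge> 1"
  shows "gap_const \<gamma> \<le> S - 2 / (\<gamma> + 1) * (S - 1 / S)"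
proof -
  have eq: "S - 2 / (\<gamma> + 1) * (S - 1 / S) = ((\<gamma> - 1) * S + 2 / S) / (\<gamma> + 1)"
  proof -
    have "((\<gamma> - 1) * S + 2 / S) = (\<gamma> + 1) * S - 2 * (S - 1 / S)"
      by (simp add: algebra_simps)
    then have "((\<gamma> - 1) * S + 2 / S) / (\<gamma> + 1)
        = (\<gamma> + 1) * S / (\<gamma> + 1) - 2 * (S - 1 / S) / (\<gamma> + 1)"
      by (simp only: diff_divide_distrib)
    then show ?thesis using g by simp
  qed
  show ?thesis
  proof (cases "\<gamma> \<le> 3")
    case True
    have "sqrt (((\<gamma> - 1) * S) * (2 / S)) \<le> ((\<gamma> - 1) * S + 2 / S) / 2"
      using g S by (intro arith_geo_mean_sqrt) auto
    moreover have "((\<gamma> - 1) * S) * (2 / S) = 2 * (\<gamma> - 1)" using S by simp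
    ultimately have "2 * sqrt (2 * (\<gamma> - 1)) \<le> (\<gamma> - 1) * S + 2 / S" by simp
    then show ?thesis
      unfolding eq using g True by (simp add: gap_const_def divide_right_mono)
  next
    case False
    have "2 * 1 \<le> (\<gamma> - 1) * S" using False S by (intro mult_mono) auto
    then have "0 \<le> (S - 1) * ((\<gamma> - 1) * S - 2)" using S by (intro mult_nonneg_nonneg) auto
    then have "(\<gamma> + 1) * S \<le> ((\<gamma> - 1) * S + 2 / S) * S"
      using S by (simp add: algebra_simps)
    then have "\<gamma> + 1 \<le> (\<gamma> - 1) * S + 2 / S" using S by simp
    then show ?thesis unfolding eq using g False by (simp add: gap_const_def)
  qed
qed

lemma one_sided_gap:
  assumes g: "\<gamma> > 1" and b: "b \<ge> 0" and adm: "admissible \<gamma> b Z" and p: "p \<ge> 0"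
  shows "gap_const \<gamma> * sound_speed \<gamma> b Z
       \<le> sound_speed \<gamma> b Z * mach \<gamma> b p Z - wave_curve \<gamma> b p Z"
proof -
  define a where "a = sound_speed \<gamma> b Z"
  define r where "r = 1 - b * dens Z"
  define S where "S = mach \<gamma> b p Z"
  have a: "a > 0" using sound_speed_pos[OF g adm] by (simp add: a_def)
  have S: "S \<ge> 1" using mach_ge_1[OF g] by (simp add: S_def)
  have r: "r \<le> 1" using b adm by (simp add: r_def admissible_def)
  show ?thesis
  proof (cases "pressure \<gamma> b Z \<le> p")
    case True
    have "0 \<le> S - 1 / S" using diff_inverse_strict_mono[of 1 S] S by (cases "S = 1") auto
    moreover have "2 / (\<gamma> + 1) * (a * r) \<le> 2 / (\<gamma> + 1) * (a * 1)"
      using a r g by (intro mult_left_mono) auto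
    ultimately have "2 / (\<gamma> + 1) * (a * r) * (S - 1 / S) \<le> 2 / (\<gamma> + 1) * (a * 1) * (S - 1 / S)"
      by (intro mult_right_mono)
    moreover have "wave_curve \<gamma> b p Z = 2 / (\<gamma> + 1) * (a * r) * (S - 1 / S)"
      using shock_branch[OF g adm True] True by (simp add: wave_curve_def a_def r_def S_def)
    moreover have "a * gap_const \<gamma> \<le> a * (S - 2 / (\<gamma> + 1) * (S - 1 / S))"
      using gap_const_le_shock[OF g S] a by (intro mult_left_mono) auto
    ultimately show ?thesis
      unfolding a_def[symmetric] S_def[symmetric] by (simp add: algebra_simps)
  next
    case False
    \<comment> \<open>the wave curve increases through its zero at \<open>p\<^sub>Z\<close>\<close>
    have "wave_curve \<gamma> b p Z \<le> 0"
      using wave_curve_strict_mono[OF g adm p, of "pressure \<gamma> b Z"] False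
      by (simp add: wave_curve_def[of _ _ "pressure \<gamma> b Z"])
    moreover have "a * gap_const \<gamma> \<le> a * S"
      using gap_const_le_1[OF g] S a by (intro mult_left_mono) auto
    ultimately show ?thesis
      unfolding a_def[symmetric] S_def[symmetric] by (simp add: mult.commute)
  qed
qed

theorem lemma4p8:
  fixes \<gamma> b :: real and L R :: euler_state
  assumes "\<gamma> > 1" and "b \<ge> 0"
    and "admissible \<gamma> b L" and "admissible \<gamma> b R"
  shows "lambda3_plus \<gamma> b L R - lambda1_minus \<gamma> b L R
           \<ge> gap_const \<gamma> * (sound_speed \<gamma> b L + sound_speed \<gamma> b R)"
proof -
  define p where "p = p_star \<gamma> b L R"
  have gap: "lambda3_plus \<gamma> b L R - lambda1_minus \<gamma> b L R
      = velocity R - velocity L + sound_speed \<gamma> b L * mach \<gamma> b p L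
          + sound_speed \<gamma> b R * mach \<gamma> b p R"
    by (simp add: lambda3_plus_def lambda1_minus_def mach_def p_def)
  have "phi \<gamma> b L R p \<ge> 0 \<and> p \<ge> 0"
  proof (cases "phi \<gamma> b L R 0 < 0")
    case True
    then show ?thesis using p_star_zero[OF assms(1,3,4)] by (simp add: p_def)
  next
    case False
    then show ?thesis by (simp add: p_def p_star_def)
  qed
  then have "velocity R - velocity L \<ge> - wave_curve \<gamma> b p L - wave_curve \<gamma> b p R" and "p \<ge> 0"
    by (auto simp: phi_def)
  then show ?thesis
    using one_sided_gap[OF assms(1,2,3), of p] one_sided_gap[OF assms(1,2,4), of p]
    unfolding gap by (simp add: algebra_simps)
qed

end
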